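(* Let $T$ be a tree on at least $3$ vertices, with diameter $\operatorname{diam}(T)$. Then $$\left\lceil\sqrt{2(\operatorname{diam}(T)+1)}-\frac12\right\rceil\le\operatorname{th}_{\gamma_P}(T)\le\operatorname{diam}(T)-1+\gamma_P(T),$$ and these bounds are tight (each is attained with equality by some such tree).
   Context: All graphs are finite, simple, undirected, and have at least one vertex. The diameter of a tree is the maximum distance (number of edges of the shortest path) between two of its vertices. For $S\subseteq V(G)$, $N[S]$ is the set of vertices in $S$ or adjacent to a vertex of $S$. Given $G=(V,E)$ and $S\subseteq V$, initially (timestep $0$) the vertices of $S$ are colored; in timestep $1$ every vertex in $N[S]$ becomes colored; in each subsequent timestep, every vertex which is the only non-colored neighbor of some colored vertex becomes colored. $S$ is a power dominating set if all vertices eventually become colored, and then $\operatorname{ppt}(G;S)$ is the number of timesteps needed to color all of $G$ (so $\operatorname{ppt}(G;V)=0$). The power domination number $\gamma_P(G)$ is the minimum cardinality of a power dominating set of $G$, and the power domination throttling number is $\operatorname{th}_{\gamma_P}(G)=\min\{|S|+\operatorname{ppt}(G;S): S \text{ a power dominating set of } G\}$. *)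

theory Defs
  imports Complex_Main "Graph_Theory.Graph_Theory"
begin

text \<open>
  A finite simple undirected graph is a \<^locale>\<open>pair_graph\<close>: finite, loop-free, with a symmetric
  set of arcs, each undirected edge \<open>uv\<close> being represented by the two arcs \<open>(u, v)\<close> and \<open>(v, u)\<close>.

  The library predicate \<^const>\<open>tree\<close> cannot be used for such graphs: it is based on directed
  cycles, and \<open>u, v, u\<close> is a directed cycle in every symmetric digraph with an edge \<open>uv\<close>.
  The cycles of the undirected graph are exactly the directed cycles of length at least 3.
  Nonemptiness of the vertex set is part of \<^const>\<open>Digraph_Component.connected\<close>.
\<close>

definition undirected_tree :: "'a pair_pre_digraph \<Rightarrow> bool" where
  "undirected_tree G \<longleftrightarrow> pair_graph G \<and> Digraph_Component.connected (with_proj G) \<and>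
     (\<nexists>p. pre_digraph.cycle (with_proj G) p \<and> length p \<ge> 3)"

text \<open>Paths are lists of arcs, so the length of the list is the number of edges. The value is
  meaningful only if \<open>v\<close> is reachable from \<open>u\<close>.\<close>

definition graph_dist :: "'a pair_pre_digraph \<Rightarrow> 'a \<Rightarrow> 'a \<Rightarrow> nat" where
  "graph_dist G u v = (LEAST n. \<exists>p. pre_digraph.apath (with_proj G) u p v \<and> length p = n)"

definition graph_diameter :: "'a pair_pre_digraph \<Rightarrow> nat" where
  "graph_diameter G = Max {graph_dist G u v | u v. u \<in> pverts G \<and> v \<in> pverts G}"

definition neighbors :: "'a pair_pre_digraph \<Rightarrow> 'a \<Rightarrow> 'a set" where
  "neighbors G u = {v. (u, v) \<in> parcs G}"

definition closed_nbhd :: "'a pair_pre_digraph \<Rightarrow> 'a set \<Rightarrow> 'a set" where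
  "closed_nbhd G S = S \<union> (\<Union>u\<in>S. neighbors G u)"

definition forcing_step :: "'a pair_pre_digraph \<Rightarrow> 'a set \<Rightarrow> 'a set" where
  "forcing_step G C = C \<union> {v. \<exists>u\<in>C. neighbors G u - C = {v}}"

fun colored :: "'a pair_pre_digraph \<Rightarrow> 'a set \<Rightarrow> nat \<Rightarrow> 'a set" where
  "colored G S 0 = S"
| "colored G S (Suc 0) = closed_nbhd G S"
| "colored G S (Suc (Suc t)) = forcing_step G (colored G S (Suc t))"

definition power_dominating :: "'a pair_pre_digraph \<Rightarrow> 'a set \<Rightarrow> bool" where
  "power_dominating G S \<longleftrightarrow> S \<subseteq> pverts G \<and> (\<exists>t. colored G S t = pverts G)"

definition ppt :: "'a pair_pre_digraph \<Rightarrow> 'a set \<Rightarrow> nat" where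
  "ppt G S = (LEAST t. colored G S t = pverts G)"

definition power_domination_number :: "'a pair_pre_digraph \<Rightarrow> nat" where
  "power_domination_number G = Min {card S | S. power_dominating G S}"

definition pd_throttling_number :: "'a pair_pre_digraph \<Rightarrow> nat" where
  "pd_throttling_number G = Min {card S + ppt G S | S. power_dominating G S}"

end

theory Submission
  imports Defs
begin

text \<open>
  \<^emph>\<open>Lower bound.\<close> A vertex colored at time \<open>t\<close> is at distance at most \<open>t\<close> from \<open>S\<close>, so a diametral
  path is covered by \<open>|S|\<close> balls of radius \<open>p = ppt G S\<close>. A ball of radius \<open>p\<close> meets a geodesic in at
  most \<open>2p + 1\<close> vertices, hence \<open>diam + 1 \<le> |S| (2p + 1)\<close>, and the right-hand side is at most
  \<open>n (n + 1) / 2\<close> where \<open>n = |S| + p\<close>.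

  \<^emph>\<open>Upper bound.\<close> Replacing each leaf in a minimum power dominating set by its neighbor, we may
  assume that \<open>S\<close> contains no leaf. A vertex that is forced at time \<open>t + 1\<close> could not be forced
  earlier because a vertex in the closed neighborhood of its forcer was colored only at time \<open>t\<close>.
  Following these delays back in time gives a non-backtracking walk of length at least \<open>ppt G S\<close>
  that starts in \<open>S\<close>; as its first vertex is no leaf, it can be prolonged by one arc. In a tree,
  non-backtracking walks are geodesics, so \<open>ppt G S + 1 \<le> diam\<close>.

  The path on three vertices attains both bounds.
\<close>

section \<open>Distances\<close>

context pair_graph
begin

lemma graph_dist_le_length_apath:
  assumes "apath u p v"
  shows "graph_dist G u v \<le> length p"
  unfolding graph_dist_def using assms by (intro Least_le) auto

text \<open>Distances minimize over paths only. Shortening a walk to a path keeps a subset of its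
  arcs, and the arcs of a path are distinct, so the length cannot grow.\<close>

lemma graph_dist_le_length_awalk:
  assumes "awalk u p v"
  shows "graph_dist G u v \<le> length p"
proof -
  have path: "apath u (awalk_to_apath p) v"
    using assms by (rule apath_awalk_to_apath)
  then have "distinct (awalk_to_apath p)"
    unfolding apath_def by (blast intro: distinct_verts_imp_distinct)
  then have "length (awalk_to_apath p) \<le> card (set p)"
    using awalk_to_apath_subset[OF assms] by (metis card_mono distinct_card finite_set)
  also have "\<dots> \<le> length p"
    by (rule card_length)
  finally show ?thesis
    using graph_dist_le_length_apath[OF path] by linarith
qed

lemma graph_dist_attained:
  assumes "awalk u p v"
  obtains q where "apath u q v" "length q = graph_dist G u v"
proof -
  have "\<exists>n q. apath u q v \<and> length q = n"
    using apath_awalk_to_apath[OF assms] by blast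
  from LeastI_ex[OF this] show ?thesis
    using that unfolding graph_dist_def by blast
qed

lemma finite_dists: "finite {graph_dist G u v | u v. u \<in> pverts G \<and> v \<in> pverts G}"
  using pair_finite_verts by (intro finite_image_set2) auto

lemma graph_dist_le_graph_diameter:
  assumes "u \<in> pverts G" "v \<in> pverts G"
  shows "graph_dist G u v \<le> graph_diameter G"
  unfolding graph_diameter_def using assms finite_dists by (intro Max_ge) auto

lemma connected_awalk:
  assumes "connected (with_proj G)" "u \<in> pverts G" "v \<in> pverts G"
  obtains p where "awalk u p v"
proof -
  \<comment> \<open>Connectedness ignores orientation; symmetry of the arcs turns it into directed
    reachability.\<close>
  have "strongly_connected (with_proj G)"
    using symmetric_connected_imp_strongly_connected pair_sym_arcs assms(1) by blast
  then have "u \<rightarrow>\<^sup>*\<^bsub>with_proj G\<^esub> v"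
    using assms unfolding strongly_connected_def by simp
  then show ?thesis
    using that reachable_awalk by blast
qed

lemma diametral_path:
  assumes "connected (with_proj G)"
  obtains u p v where "apath u p v" "length p = graph_diameter G" "graph_dist G u v = graph_diameter G"
proof -
  obtain w where "w \<in> pverts G"
    using assms unfolding connected_def strongly_connected_def mk_symmetric_def by auto
  then have "{graph_dist G u v | u v. u \<in> pverts G \<and> v \<in> pverts G} \<noteq> {}"
    by blast
  then have "graph_diameter G \<in> {graph_dist G u v | u v. u \<in> pverts G \<and> v \<in> pverts G}"
    unfolding graph_diameter_def using finite_dists by (rule Max_in[rotated])
  then obtain u v where uv: "u \<in> pverts G" "v \<in> pverts G" "graph_dist G u v = graph_diameter G"
    by auto
  obtain p where "awalk u p v"
    using connected_awalk[OF assms uv(1,2)] .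
  then show ?thesis
    using uv(3) that by (elim graph_dist_attained) auto
qed

section \<open>Spread of the coloring\<close>

lemma neighbors_subset: "neighbors G u \<subseteq> pverts G"
  unfolding neighbors_def by (auto dest: in_arcsD2)

lemma closed_nbhd_subset: "S \<subseteq> pverts G \<Longrightarrow> closed_nbhd G S \<subseteq> pverts G"
  unfolding closed_nbhd_def using neighbors_subset by blast

lemma forcing_step_subset: "C \<subseteq> pverts G \<Longrightarrow> forcing_step G C \<subseteq> pverts G"
  unfolding forcing_step_def using neighbors_subset by blast

lemma colored_subset:
  assumes "S \<subseteq> pverts G"
  shows "colored G S t \<subseteq> pverts G"
  using assms
proof (induction t)
  case (Suc t)
  then show ?case
    by (cases t) (simp_all add: closed_nbhd_subset forcing_step_subset)
qed simp

lemma colored_Suc_superset: "colored G S t \<subseteq> colored G S (Suc t)"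
  by (cases t) (auto simp: closed_nbhd_def forcing_step_def)

lemma colored_Suc_cases:
  assumes "x \<in> colored G S (Suc t)"
  obtains "x \<in> colored G S t" | u where "u \<in> colored G S t" "x \<in> neighbors G u"
  using assms by (cases t) (auto simp: closed_nbhd_def forcing_step_def)

text \<open>Either rule colors only neighbors of colored vertices, so a timestep costs at most one
  arc.\<close>

lemma colored_awalk:
  assumes "S \<subseteq> pverts G" "x \<in> colored G S t"
  obtains s p where "s \<in> S" "awalk s p x" "length p \<le> t"
proof -
  have "\<exists>s\<in>S. \<exists>p. awalk s p x \<and> length p \<le> t"
    using assms(2)
  proof (induction t arbitrary: x)
    case 0
    then have "awalk x [] x"
      using assms(1) by (auto simp: awalk_Nil_iff)
    then show ?case
      using 0 by auto
  next
    case (Suc t)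
    from Suc.prems show ?case
    proof (cases rule: colored_Suc_cases)
      case 1
      then show ?thesis
        using Suc.IH le_SucI by meson
    next
      case (2 u)
      then obtain s p where sp: "s \<in> S" "awalk s p u" "length p \<le> t"
        using Suc.IH by blast
      have "awalk u [(u, x)] x"
        using 2(2) in_arcsD2 by (auto simp: awalk_simps neighbors_def)
      with sp(2) have "awalk s (p @ [(u, x)]) x"
        by (rule awalk_appendI)
      then show ?thesis
        using sp by (intro bexI[of _ s] exI[of _ "p @ [(u, x)]"]) auto
    qed
  qed
  then show ?thesis
    using that by blast
qed

section \<open>Monotonicity of the coloring\<close>

lemma forcing_step_mono:
  assumes "C \<subseteq> D"
  shows "forcing_step G C \<subseteq> forcing_step G D"
proof
  fix v assume "v \<in> forcing_step G C"
  then consider "v \<in> C" | u where "u \<in> C" "neighbors G u - C = {v}"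
    unfolding forcing_step_def by auto
  then show "v \<in> forcing_step G D"
  proof cases
    case (2 u)
    \<comment> \<open>If \<open>v\<close> is not yet in \<open>D\<close>, it is still the only
      neighbor of \<open>u\<close> outside the larger set.\<close>
    then have "u \<in> D" "v \<in> D \<or> neighbors G u - D = {v}"
      using assms by blast+
    then show ?thesis
      unfolding forcing_step_def by auto
  qed (use assms in \<open>auto simp: forcing_step_def\<close>)
qed

text \<open>The comparison starts at time 1 because \<open>S\<close> itself need not lie in
  \<open>S'\<close>.\<close>

lemma colored_Suc_mono:
  assumes "closed_nbhd G S \<subseteq> closed_nbhd G S'"
  shows "colored G S (Suc t) \<subseteq> colored G S' (Suc t)"
  using assms by (induction t) (simp_all add: forcing_step_mono)

lemma power_dominating_closed_nbhd_mono:
  assumes "power_dominating G S" "closed_nbhd G S \<subseteq> closed_nbhd G S'" "S' \<subseteq> pverts G"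
  shows "power_dominating G S'"
proof -
  obtain t where t: "colored G S t = pverts G"
    using assms(1) unfolding power_dominating_def by blast
  \<comment> \<open>As \<open>t\<close> may be 0, where no comparison is available, one more
    timestep is spent.\<close>
  have "pverts G \<subseteq> colored G S' (Suc t)"
    using colored_Suc_superset[of S t] colored_Suc_mono[OF assms(2), of t] t by simp
  then show ?thesis
    using assms(3) colored_subset[OF assms(3)] unfolding power_dominating_def by blast
qed

section \<open>The last timestep and minimizing sets\<close>

lemma colored_ppt:
  assumes "power_dominating G S"
  shows "colored G S (ppt G S) = pverts G"
  unfolding ppt_def
proof (rule LeastI_ex)
  show "\<exists>t. colored G S t = pverts G"
    using assms unfolding power_dominating_def by blast
qed

lemma colored_before_ppt: "t < ppt G S \<Longrightarrow> colored G S t \<noteq> pverts G"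
  unfolding ppt_def using not_less_Least[of t "\<lambda>t. colored G S t = pverts G"] by blast

text \<open>Keeps the sets under both \<open>Min\<close> nonempty, so that the minima are
  attained.\<close>

lemma power_dominating_verts: "power_dominating G (pverts G)"
  unfolding power_dominating_def by (intro conjI exI[of _ 0]) simp_all

lemma finite_power_dominating: "finite {f S | S. power_dominating G S}"
proof -
  have "finite {S. power_dominating G S}"
    by (rule finite_subset[of _ "Pow (pverts G)"])
      (auto simp: power_dominating_def pair_finite_verts)
  then show ?thesis
    by (rule finite_image_set)
qed

lemma power_domination_number_le:
  "power_dominating G S \<Longrightarrow> power_domination_number G \<le> card S"
  unfolding power_domination_number_def
  by (intro Min_le finite_power_dominating) auto

lemma pd_throttling_number_le:
  "power_dominating G S \<Longrightarrow> pd_throttling_number G \<le> card S + ppt G S"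
  unfolding pd_throttling_number_def
  by (intro Min_le finite_power_dominating) auto

lemma power_domination_number_attained:
  obtains S where "power_dominating G S" "card S = power_domination_number G"
proof -
  have "power_domination_number G \<in> {card S | S. power_dominating G S}"
    unfolding power_domination_number_def
    using power_dominating_verts by (intro Min_in finite_power_dominating) auto
  then show ?thesis
    using that by auto
qed

lemma pd_throttling_number_attained:
  obtains S where "power_dominating G S" "card S + ppt G S = pd_throttling_number G"
proof -
  have "pd_throttling_number G \<in> {card S + ppt G S | S. power_dominating G S}"
    unfolding pd_throttling_number_def
    using power_dominating_verts by (intro Min_in finite_power_dominating) auto
  then show ?thesis
    using that by auto
qed

section \<open>The lower bound\<close>

lemma length_rev_path: "length (rev_path p) = length p"
  by (induction p) auto

lemma awalk_take_drop:
  assumes "awalk u p v" "i \<le> length p"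
  shows "awalk u (take i p) (pawalk_verts u p ! i)" "awalk (pawalk_verts u p ! i) (drop i p) v"
proof -
  have "awalk u (take i p) (pawalk_verts u p ! i) \<and> awalk (pawalk_verts u p ! i) (drop i p) v"
    using assms
  proof (induction p arbitrary: u i)
    case Nil
    then show ?case by (auto simp: awalk_Nil_iff)
  next
    case (Cons e p)
    then show ?case
      by (cases i) (auto simp: awalk_simps dest: arc_fst_in_verts)
  qed
  then show "awalk u (take i p) (pawalk_verts u p ! i)" "awalk (pawalk_verts u p ! i) (drop i p) v"
    by blast+
qed

text \<open>Replacing the segment between positions \<open>i\<close> and \<open>j\<close> by the
  detour through \<open>s\<close> gives a walk of length
  \<open>i + length a + length b + (length p - j)\<close>, which cannot beat a geodesic.\<close>

lemma geodesic_gap: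
  assumes "awalk u p v" "length p = graph_dist G u v" "i \<le> j" "j \<le> length p"
    and "awalk s a (pawalk_verts u p ! i)" "awalk s b (pawalk_verts u p ! j)"
  shows "j \<le> i + length a + length b"
proof -
  have "awalk u (take i p @ rev_path a @ b @ drop j p) v"
    using assms by (intro awalk_appendI[OF awalk_take_drop(1)] awalk_appendI[OF awalk_rev_path']
        awalk_appendI[OF _ awalk_take_drop(2)]) auto
  from graph_dist_le_length_awalk[OF this] show ?thesis
    using assms(2-4) by (simp add: length_rev_path)
qed

lemma geodesic_length_less:
  assumes "power_dominating G S" "awalk u p v" "length p = graph_dist G u v"
  shows "length p < card S * (2 * ppt G S + 1)"
proof -
  \<comment> \<open>The positions on the geodesic in the ball around \<open>s\<close>. Positions run
    from 0 to \<open>length p\<close>, which makes the final inequality strict.\<close>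
  let ?I = "\<lambda>s. {i. i \<le> length p \<and> (\<exists>a. awalk s a (pawalk_verts u p ! i) \<and> length a \<le> ppt G S)}"
  have S: "S \<subseteq> pverts G"
    using assms(1) unfolding power_dominating_def by blast
  then have "finite S"
    using pair_finite_verts finite_subset by blast
  have "{..length p} \<subseteq> (\<Union>s\<in>S. ?I s)"
  proof
    fix i assume i: "i \<in> {..length p}"
    then have "pawalk_verts u p ! i \<in> colored G S (ppt G S)"
      using awalk_last_in_verts[OF awalk_take_drop(1)[OF assms(2)], of i] colored_ppt[OF assms(1)]
      by auto
    with S show "i \<in> (\<Union>s\<in>S. ?I s)"
      using i by (elim colored_awalk) auto
  qed
  moreover have "finite (\<Union>s\<in>S. ?I s)"
    using \<open>finite S\<close> by auto
  ultimately have "card {..length p} \<le> card (\<Union>s\<in>S. ?I s)"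
    by (intro card_mono)
  also have "\<dots> \<le> (\<Sum>s\<in>S. card (?I s))"
    using \<open>finite S\<close> by (rule card_UN_le)
  also have "\<dots> \<le> (\<Sum>s\<in>S. 2 * ppt G S + 1)"
  proof (rule sum_mono)
    fix s assume "s \<in> S"
    show "card (?I s) \<le> 2 * ppt G S + 1"
    proof (cases "?I s = {}")
      case False
      define m where "m = Min (?I s)"
      have m: "m \<in> ?I s"
        unfolding m_def using False by (intro Min_in) auto
      \<comment> \<open>By \<open>geodesic_gap\<close>, through \<open>s\<close>, no position in the
        ball is more than two radii beyond the least one.\<close>
      have "?I s \<subseteq> {m..m + 2 * ppt G S}"
      proof
        fix j assume j: "j \<in> ?I s"
        have "m \<le> j"
          unfolding m_def using j by (intro Min_le) auto
        moreover have "j \<le> m + 2 * ppt G S"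
        proof -
          obtain a b where ab: "awalk s a (pawalk_verts u p ! m)" "length a \<le> ppt G S"
            "awalk s b (pawalk_verts u p ! j)" "length b \<le> ppt G S"
            using m j by blast
          then show ?thesis
            using geodesic_gap[OF assms(2,3) \<open>m \<le> j\<close> _ ab(1,3)] j by simp
        qed
        ultimately show "j \<in> {m..m + 2 * ppt G S}"
          by simp
      qed
      from card_mono[OF _ this] show ?thesis
        by simp
    qed (simp only: card.empty)
  qed
  finally show ?thesis
    by simp
qed

text \<open>Doubled, the two sides differ by \<open>(k - p) (k - p - 1)\<close>, a product of consecutive integers.\<close>

lemma mult_le_triangular:
  fixes k p :: nat
  shows "2 * (k * (2 * p + 1)) \<le> (k + p) * (k + p + 1)"
proof -
  \<comment> \<open>Taken over \<open>int\<close> because subtraction on \<open>nat\<close>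
    truncates; consecutive integers never have opposite signs.\<close>
  have "0 \<le> (int k - int p) * (int k - int p - 1)"
    by (cases "int k \<le> int p") (auto intro: mult_nonneg_nonneg mult_nonpos_nonpos)
  then have "int (2 * (k * (2 * p + 1))) \<le> int ((k + p) * (k + p + 1))"
    by (simp add: algebra_simps)
  then show ?thesis
    by linarith
qed

lemma pd_throttling_number_lower_bound:
  assumes "connected (with_proj G)"
  shows "\<lceil>sqrt (2 * (real (graph_diameter G) + 1)) - 1 / 2\<rceil> \<le> int (pd_throttling_number G)"
proof -
  define n where "n = pd_throttling_number G"
  obtain u p v where p: "apath u p v" "length p = graph_diameter G" "graph_dist G u v = graph_diameter G"
    using diametral_path[OF assms] .
  obtain S where S: "power_dominating G S" "card S + ppt G S = n"
    using pd_throttling_number_attained unfolding n_def .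
  have "2 * (graph_diameter G + 1) \<le> 2 * (card S * (2 * ppt G S + 1))"
    using geodesic_length_less[OF S(1) awalkI_apath[OF p(1)]] p by simp
  also have "\<dots> \<le> n * (n + 1)"
    using mult_le_triangular S(2) by blast
  finally have "real (2 * (graph_diameter G + 1)) \<le> real (n * (n + 1))"
    by (rule of_nat_mono)
  \<comment> \<open>Completing the square adds 1/4 to \<open>n * (n + 1)\<close>; this is the source
    of the 1/2 in the bound.\<close>
  then have "2 * (real (graph_diameter G) + 1) \<le> (real n + 1 / 2)\<^sup>2"
    by (simp add: power2_eq_square algebra_simps)
  then have "sqrt (2 * (real (graph_diameter G) + 1)) \<le> real n + 1 / 2"
    by (intro real_le_lsqrt) auto
  then show ?thesis
    unfolding n_def[symmetric] by (simp add: ceiling_le_iff)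
qed

section \<open>Non-backtracking walks in trees\<close>

end

text \<open>Non-backtracking: for consecutive arcs \<open>e\<close>, \<open>f\<close> of a walk,
  \<open>snd f = fst e\<close> means that \<open>f\<close> is \<open>e\<close> reversed.\<close>

definition reduced :: "('a \<times> 'a) awalk \<Rightarrow> bool" where
  "reduced = successively (\<lambda>e f. snd f \<noteq> fst e)"

lemma reduced_simps [simp]: "reduced []" "reduced [e]"
  by (simp_all add: reduced_def)

lemma reduced_Cons_iff: "reduced (e # p) \<longleftrightarrow> p = [] \<or> snd (hd p) \<noteq> fst e \<and> reduced p"
  by (simp add: reduced_def successively_Cons)

lemma reduced_append_iff:
  "reduced (p @ q) \<longleftrightarrow>
     reduced p \<and> reduced q \<and> (p = [] \<or> q = [] \<or> snd (hd q) \<noteq> fst (last p))"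
  by (simp add: reduced_def successively_append_iff)

lemma last_rev_path: "p \<noteq> [] \<Longrightarrow> last (rev_path p) = (snd (hd p), fst (hd p))"
  by (cases p) auto

lemma reduced_rev_path: "reduced (rev_path p) \<longleftrightarrow> reduced p"
  by (induction p) (auto simp: reduced_append_iff reduced_Cons_iff last_rev_path)

locale tree_graph = pair_graph +
  assumes connected: "connected (with_proj G)"
    and no_cycle: "cycle p \<Longrightarrow> length p < 3"
begin

text \<open>Since the tail has distinct vertices by induction, a return to \<open>u\<close> closes a
  cycle \<open>e # q\<close>. Length 3 or more is excluded in a tree, length 2 by reducedness,
  length 1 by the absence of loops.\<close>

lemma reduced_imp_distinct:
  assumes "awalk u p v" "reduced p"
  shows "distinct (pawalk_verts u p)"
  using assms
proof (induction p arbitrary: u)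
  case (Cons e p)
  then have e: "e \<in> parcs G" "u = fst e" and p: "awalk (snd e) p v"
    by (simp_all add: awalk_Cons_iff)
  have dist: "distinct (pawalk_verts (snd e) p)"
    using Cons p by (auto simp: reduced_Cons_iff)
  have "u \<notin> set (pawalk_verts (snd e) p)"
  proof
    assume "u \<in> set (pawalk_verts (snd e) p)"
    then obtain q r where qr: "p = q @ r" "awalk (snd e) q u"
      using awalk_decomp[OF p] by blast
    have "pawalk_verts (snd e) p = pawalk_verts (snd e) q @ tl (pawalk_verts u r)"
      using awalk_verts_append[of "snd e" q r v] p qr by simp
    then have "distinct (pawalk_verts (snd e) q)"
      using dist by simp
    moreover have "awalk u (e # q) u"
      using e qr(2) by (simp add: awalk_Cons_iff)
    ultimately have "cycle (e # q)"
      unfolding cycle_def by (intro exI[of _ u]) simp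
    then have "length q < 2"
      using no_cycle[of "e # q"] by simp
    then consider "q = []" | f where "q = [f]"
      by (cases q) auto
    then show False
    proof cases
      case 1
      then show False
        using e qr(2) pair_no_loops[of e] by (simp add: awalk_Nil_iff)
    next
      case (2 f)
      then show False
        using e qr Cons.prems(2) by (auto simp: awalk_simps reduced_Cons_iff)
    qed
  qed
  then show ?case
    using dist e by simp
qed simp

text \<open>Where two reduced walks branch off, the reverse of one followed by the other is a
  nonempty closed reduced walk, hence a path from \<open>v\<close> to itself, which is
  absurd.\<close>

lemma reduced_unique:
  assumes "awalk u p v" "awalk u q v" "reduced p" "reduced q"
  shows "p = q"
  using assms
proof (induction p arbitrary: u q)
  case Nil
  then have "apath u q u"
    using reduced_imp_distinct by (auto simp: apath_def awalk_Nil_iff)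
  then show ?case
    using apath_nonempty_ends by blast
next
  case (Cons e p)
  have "q \<noteq> []"
  proof
    assume "q = []"
    then have "apath u (e # p) u"
      using Cons.prems reduced_imp_distinct[of u "e # p" u]
      unfolding apath_def by (simp only: awalk_Nil_iff)
    then show False
      using apath_nonempty_ends by blast
  qed
  then obtain f q' where q: "q = f # q'"
    by (cases q) auto
  have "e = f"
  proof (rule ccontr)
    assume "e \<noteq> f"
    have ends: "fst e = u" "fst f = u"
      using Cons.prems q by (auto simp: awalk_Cons_iff)
    \<comment> \<open>The reversed walk ends with \<open>e\<close> reversed, so this is the
      condition for not backtracking at the junction.\<close>
    then have "snd f \<noteq> snd e"
      using \<open>e \<noteq> f\<close> by (auto simp: prod_eq_iff)
    then have "reduced (rev_path (e # p) @ q)"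
      using Cons.prems q
      by (simp only: reduced_append_iff reduced_rev_path last_rev_path list.sel) auto
    moreover have "awalk v (rev_path (e # p) @ q) v"
      using Cons.prems by (intro awalk_appendI[of v _ u]) (simp_all only: awalk_rev_path)
    ultimately have "apath v (rev_path (e # p) @ q) v"
      using reduced_imp_distinct by (simp only: apath_def)
    then show False
      using apath_nonempty_ends q by blast
  qed
  moreover have "p = q'"
    using Cons.IH[of "snd e" q'] Cons.prems q \<open>e = f\<close>
    by (auto simp: awalk_Cons_iff reduced_Cons_iff)
  ultimately show ?case
    using q by simp
qed

lemma apath_imp_reduced:
  assumes "apath u p v"
  shows "reduced p"
  using assms
proof (induction p arbitrary: u)
  case (Cons e p)
  then show ?case
    by (cases p) (auto simp: apath_Cons_iff reduced_Cons_iff hd_in_awalk_verts)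
qed simp

lemma graph_dist_eq_length_reduced:
  assumes "awalk u p v" "reduced p"
  shows "graph_dist G u v = length p"
proof -
  obtain q where q: "apath u q v" "length q = graph_dist G u v"
    using graph_dist_attained[OF assms(1)] .
  then have "q = p"
    using reduced_unique assms apath_imp_reduced awalkI_apath by blast
  then show ?thesis
    using q(2) by simp
qed

text \<open>Reduces the upper bound to exhibiting a long enough reduced walk.\<close>

lemma length_reduced_le_graph_diameter:
  assumes "awalk u p v" "reduced p"
  shows "length p \<le> graph_diameter G"
  using graph_dist_eq_length_reduced[OF assms] graph_dist_le_graph_diameter[of u v]
    awalk_hd_in_verts[OF assms(1)] awalk_last_in_verts[OF assms(1)] by simp

section \<open>The upper bound\<close>

text \<open>
  The last two conjuncts make the induction work: a vertex \<open>u'\<close> that still has an uncolored neighbor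
  at time \<open>t + 1\<close> differs from \<open>u\<close>, so prolonging the walk by \<open>u'\<close> is no backtracking.
\<close>

lemma forcing_trace:
  assumes "S \<subseteq> pverts G" "v \<in> colored G S (Suc t)" "v \<notin> colored G S t"
  shows "\<exists>s\<in>S. \<exists>p u. awalk s (p @ [(u, v)]) v \<and> reduced (p @ [(u, v)]) \<and> t \<le> length p \<and>
           u \<in> colored G S t \<and> neighbors G u \<subseteq> colored G S (Suc t)"
  using assms(2,3)
proof (induction t arbitrary: v)
  case 0
  then obtain s where s: "s \<in> S" "v \<in> neighbors G s"
    by (auto simp: closed_nbhd_def)
  then have "awalk s [(s, v)] v"
    using in_arcsD2 by (auto simp: awalk_simps neighbors_def)
  then show ?case
    using s by (intro bexI[of _ s] exI[of _ "[]"] exI[of _ s]) (auto simp: closed_nbhd_def)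
next
  case (Suc t)
  let ?C = "colored G S"
  have grow: "?C t \<subseteq> ?C (Suc t)" "?C (Suc t) \<subseteq> ?C (Suc (Suc t))"
    by (rule colored_Suc_superset)+
  obtain u where u: "u \<in> ?C (Suc t)" "neighbors G u - ?C (Suc t) = {v}"
    using Suc.prems by (auto simp: forcing_step_def)
  have v: "(u, v) \<in> parcs G" "v \<noteq> u"
    using u Suc.prems(2) by (auto simp: neighbors_def)
  have uv: "awalk u [(u, v)] v"
    using v(1) in_arcsD2 by (auto simp: awalk_simps)
  have "neighbors G u \<subseteq> insert v (?C (Suc t))"
    using u(2) by blast
  then have nbrs: "neighbors G u \<subseteq> ?C (Suc (Suc t))"
    using Suc.prems(1) grow(2) by blast
  \<comment> \<open>\<open>w\<close> is the cause of the delay: either the forcer \<open>u\<close>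
    itself was uncolored at time \<open>t\<close>, or \<open>u\<close> then had a second uncolored
    neighbor besides \<open>v\<close>.\<close>
  obtain w where w: "w \<in> ?C (Suc t)" "w \<notin> ?C t" "w = u \<or> w \<in> neighbors G u"
  proof (cases "u \<in> ?C t")
    case True
    have "neighbors G u - ?C t \<noteq> {v}"
    proof
      assume eq: "neighbors G u - ?C t = {v}"
      \<comment> \<open>At \<open>t = 0\<close> all neighbors of \<open>u\<close> get colored; later
        \<open>u\<close> forces \<open>v\<close>.\<close>
      then have "v \<in> ?C (Suc t)"
        using True by (cases t) (auto simp: closed_nbhd_def forcing_step_def)
      then show False
        using Suc.prems(2) by blast
    qed
    moreover have "v \<in> neighbors G u - ?C t"
      using u(2) Suc.prems(2) grow(1) by blast
    ultimately obtain w where "w \<in> neighbors G u - ?C t" "w \<noteq> v"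
      by blast
    then show ?thesis
      using that u(2) by blast
  next
    case False
    then show ?thesis
      using that u(1) by blast
  qed
  obtain s p x where IH: "s \<in> S" "awalk s (p @ [(x, w)]) w" "reduced (p @ [(x, w)])"
    "t \<le> length p" "x \<in> ?C t" "neighbors G x \<subseteq> ?C (Suc t)"
    using Suc.IH[OF w(1,2)] by blast
  \<comment> \<open>These two facts exclude backtracking at \<open>w\<close>, whether the walk goes
    on to \<open>v\<close> directly or via \<open>u\<close>.\<close>
  have "x \<noteq> v"
    using IH(5) grow(1) Suc.prems(2) by blast
  have "x \<noteq> u"
    using IH(6) u(2) by blast
  show ?case
  proof (cases "w = u")
    case True
    have "awalk s ((p @ [(x, w)]) @ [(u, v)]) v"
      using uv True by (intro awalk_appendI[OF IH(2)]) simp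
    moreover have "reduced ((p @ [(x, w)]) @ [(u, v)])"
      using IH(3) \<open>x \<noteq> v\<close> by (subst reduced_append_iff) simp
    ultimately show ?thesis
      using IH(1,4) u(1) nbrs
      by (intro bexI[of _ s] exI[of _ "p @ [(x, w)]"] exI[of _ u]) auto
  next
    case False
    \<comment> \<open>Passing from \<open>w\<close> through \<open>u\<close> takes two arcs; the
      walk only gets longer than required.\<close>
    then have "(w, u) \<in> parcs G"
      using w(3) arcs_symmetric by (auto simp: neighbors_def)
    then have "awalk s ((p @ [(x, w)]) @ [(w, u), (u, v)]) v"
      using uv by (intro awalk_appendI[OF IH(2)]) (simp add: awalk_Cons_iff)
    moreover have "reduced ((p @ [(x, w)]) @ [(w, u), (u, v)])"
      using IH(3) \<open>x \<noteq> u\<close> w(1) Suc.prems(2)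
      by (subst reduced_append_iff) (auto simp: reduced_Cons_iff)
    ultimately show ?thesis
      using IH(1,4) u(1) nbrs
      by (intro bexI[of _ s] exI[of _ "p @ [(x, w), (w, u)]"] exI[of _ u]) auto
  qed
qed

text \<open>The trace of a vertex colored last has at least \<open>ppt G S\<close> arcs. As
  \<open>s\<close> has degree at least 2, which is what \<open>noleaf\<close> says, one more arc can
  be put in front without backtracking.\<close>

lemma ppt_less_graph_diameter:
  assumes "power_dominating G S"
    and noleaf: "\<And>s y. s \<in> S \<Longrightarrow> \<exists>z\<in>neighbors G s. z \<noteq> y"
    and "ppt G S > 0"
  shows "ppt G S < graph_diameter G"
proof -
  obtain t where t: "ppt G S = Suc t"
    using assms(3) by (cases "ppt G S") auto
  have S: "S \<subseteq> pverts G"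
    using assms(1) unfolding power_dominating_def by blast
  have "colored G S t \<noteq> pverts G" "colored G S (Suc t) = pverts G"
    using colored_before_ppt[of t S] colored_ppt[OF assms(1)] t by simp_all
  then obtain v where "v \<in> colored G S (Suc t)" "v \<notin> colored G S t"
    using colored_subset[OF S, of t] by blast
  then obtain s p u where p: "s \<in> S" "awalk s (p @ [(u, v)]) v" "reduced (p @ [(u, v)])" "t \<le> length p"
    using forcing_trace[OF S] by blast
  obtain z where z: "z \<in> neighbors G s" "z \<noteq> snd (hd (p @ [(u, v)]))"
    using noleaf[OF p(1)] by blast
  have "awalk z ((z, s) # p @ [(u, v)]) v"
    using z(1) p(2) arcs_symmetric by (simp add: awalk_Cons_iff neighbors_def del: awalk_append_iff)
  moreover have "reduced ((z, s) # p @ [(u, v)])"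
    using z(2) p(3) by (simp add: reduced_Cons_iff)
  ultimately have "length ((z, s) # p @ [(u, v)]) \<le> graph_diameter G"
    by (rule length_reduced_le_graph_diameter)
  then show ?thesis
    using t p(4) by simp
qed

section \<open>Replacing leaves\<close>

lemma neighbor_closed_eq_verts:
  assumes "A \<subseteq> pverts G" "a \<in> A" "\<And>x. x \<in> A \<Longrightarrow> neighbors G x \<subseteq> A"
  shows "A = pverts G"
proof -
  have closed: "y \<in> A" if "awalk x p y" "x \<in> A" for x p y
    using that
  proof (induction p arbitrary: x)
    case (Cons e p)
    then have "snd e \<in> neighbors G x"
      by (cases e) (auto simp: awalk_Cons_iff neighbors_def)
    then show ?case
      using Cons assms(3) by (auto simp: awalk_Cons_iff)
  qed (simp add: awalk_Nil_iff)
  have "y \<in> A" if "y \<in> pverts G" for y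
    using connected_awalk[OF connected _ that, of a] closed[OF _ assms(2)] assms(1,2) by blast
  then show ?thesis
    using assms(1) by blast
qed

text \<open>A leaf \<open>s\<close> gives way to its only neighbor \<open>y\<close>, as the closed
  neighborhood of \<open>s\<close> is \<open>{s, y}\<close>. Were \<open>y\<close> a leaf too,
  \<open>{s, y}\<close> would be closed under neighbors and thus the whole graph, contrary to having
  3 vertices.\<close>

lemma ex_nonleaf_dominating:
  assumes "card (pverts G) \<ge> 3" "s \<in> pverts G"
  obtains s' where "s' \<in> pverts G" "closed_nbhd G {s} \<subseteq> closed_nbhd G {s'}"
    "\<And>y. \<exists>z\<in>neighbors G s'. z \<noteq> y"
proof (cases "\<exists>y. neighbors G s \<subseteq> {y}")
  case False
  then have "\<exists>z\<in>neighbors G s. z \<noteq> y" for y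
    by blast
  then show ?thesis
    using that[of s] assms(2) by blast
next
  case True
  then obtain y where y: "neighbors G s \<subseteq> {y}"
    by blast
  have not_all: "pverts G \<noteq> A" if "finite A" "card A < 3" for A
    using that assms(1) by auto
  have "neighbors G s \<noteq> {}"
    using neighbor_closed_eq_verts[of "{s}" s] assms(2) not_all[of "{s}"] by auto
  with y have y: "neighbors G s = {y}"
    by blast
  then have arcs: "(s, y) \<in> parcs G" "(y, s) \<in> parcs G"
    using arcs_symmetric by (auto simp: neighbors_def)
  show ?thesis
  proof (rule that[of y])
    show "y \<in> pverts G"
      using arcs(1) by (rule in_arcsD2)
    show "closed_nbhd G {s} \<subseteq> closed_nbhd G {y}"
      using y arcs by (auto simp: closed_nbhd_def neighbors_def)
    show "\<exists>z\<in>neighbors G y. z \<noteq> x" for x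
    proof (rule ccontr)
      assume "\<not> ?thesis"
      then have "neighbors G y \<subseteq> {s}"
        using arcs(2) by (auto simp: neighbors_def)
      then have "{s, y} = pverts G"
        using y assms(2) \<open>y \<in> pverts G\<close> by (intro neighbor_closed_eq_verts[of _ s]) auto
      then show False
        using not_all[of "{s, y}"] card_insert_le_m1[of 2 "{y}" s] by auto
    qed
  qed
qed

lemma pd_throttling_number_upper_bound:
  assumes "card (pverts G) \<ge> 3"
  shows "pd_throttling_number G + 1 \<le> graph_diameter G + power_domination_number G"
proof -
  obtain S where S: "power_dominating G S" "card S = power_domination_number G"
    using power_domination_number_attained .
  then have sub: "S \<subseteq> pverts G"
    unfolding power_dominating_def by blast
  have "\<forall>s\<in>pverts G. \<exists>s'. s' \<in> pverts G \<and> closed_nbhd G {s} \<subseteq> closed_nbhd G {s'} \<and>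
      (\<forall>y. \<exists>z\<in>neighbors G s'. z \<noteq> y)"
    using ex_nonleaf_dominating[OF assms] by metis
  then obtain f where f: "\<And>s. s \<in> pverts G \<Longrightarrow> f s \<in> pverts G"
    "\<And>s. s \<in> pverts G \<Longrightarrow> closed_nbhd G {s} \<subseteq> closed_nbhd G {f s}"
    "\<And>s y. s \<in> pverts G \<Longrightarrow> \<exists>z\<in>neighbors G (f s). z \<noteq> y"
    by metis
  have "closed_nbhd G S \<subseteq> closed_nbhd G (f ` S)"
    using f(2) sub unfolding closed_nbhd_def by blast
  then have dom: "power_dominating G (f ` S)"
    using f(1) sub by (auto intro: power_dominating_closed_nbhd_mono[OF S(1)])
  \<comment> \<open>Leaves with a common neighbor may be merged, which only helps.\<close>
  have "card (f ` S) \<le> card S"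
    using finite_subset[OF sub pair_finite_verts] by (rule card_image_le)
  moreover have "ppt G (f ` S) < graph_diameter G"
  proof (cases "ppt G (f ` S) > 0")
    case True
    then show ?thesis
      using f(3) sub by (intro ppt_less_graph_diameter dom) auto
  next
    case False
    \<comment> \<open>With \<open>ppt\<close> zero it remains to see that the diameter is positive:
      a single arc is a reduced walk.\<close>
    obtain x where "x \<in> pverts G"
      using assms by fastforce
    then obtain z where "(f x, z) \<in> parcs G"
      using f(3) by (auto simp: neighbors_def)
    then have "awalk (f x) [(f x, z)] z"
      using in_arcsD2 by (auto simp: awalk_simps)
    from length_reduced_le_graph_diameter[OF this] False show ?thesis
      by simp
  qed
  ultimately show ?thesis
    using pd_throttling_number_le[OF dom] S(2) by linarith
qed

end

lemma undirected_tree_iff_tree_graph: "undirected_tree G \<longleftrightarrow> tree_graph G"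
  unfolding undirected_tree_def tree_graph_def tree_graph_axioms_def
  by (auto simp: not_le)

section \<open>The path on three vertices\<close>

definition path3 :: "nat pair_pre_digraph" where
  "path3 = \<lparr>pverts = {0, 1, 2}, parcs = {(0, 1), (1, 0), (1, 2), (2, 1)}\<rparr>"

lemma path3_simps [simp]:
  "pverts path3 = {0, 1, 2}" "parcs path3 = {(0, 1), (1, 0), (1, 2), (2, 1)}"
  by (simp_all add: path3_def)

interpretation path3: pair_graph path3
  by unfold_locales (auto simp: symmetric_def intro: symI)

lemma path3_connected: "connected (with_proj path3)"
proof -
  have "u \<rightarrow>\<^sup>*\<^bsub>with_proj path3\<^esub> 1 \<and> 1 \<rightarrow>\<^sup>*\<^bsub>with_proj path3\<^esub> u" if "u \<in> {0, 1, 2}" for u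
  proof -
    have "path3.awalk u (if u = 1 then [] else [(u, 1)]) 1"
      "path3.awalk 1 (if u = 1 then [] else [(1, u)]) u"
      using that by (auto simp: path3.awalk_simps)
    then show ?thesis
      using path3.reachable_awalk by blast
  qed
  then have "strongly_connected (with_proj path3)"
    unfolding strongly_connected_def by (auto intro: path3.reachable_trans)
  \<comment> \<open>\<open>connected\<close> is defined through the symmetric closure, which changes
    nothing here.\<close>
  moreover have "mk_symmetric (with_proj path3) = path3"
    unfolding mk_symmetric_def by (auto simp: path3_def)
  ultimately show ?thesis
    unfolding connected_def by simp
qed

text \<open>A cycle has no more arcs than there are vertices, here 3. A closed walk of length 3 is
  impossible since every arc changes parity.\<close>

lemma path3_cycle_length:
  assumes "path3.cycle p"
  shows "length p < 3"
proof (rule ccontr)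
  assume "\<not> length p < 3"
  obtain u where u: "path3.awalk u p u" "distinct (tl (pawalk_verts u p))"
    using assms unfolding path3.cycle_def by blast
  have "set (tl (pawalk_verts u p)) \<subseteq> {0, 1, 2}"
    using u(1) list.set_sel(2)[OF path3.awalk_verts_non_Nil[of u p]] path3_simps(1)
    unfolding path3.awalk_conv by blast
  then have "card (set (tl (pawalk_verts u p))) \<le> card {0, 1, 2 :: nat}"
    by (intro card_mono) auto
  then have "length p \<le> 3"
    using distinct_card[OF u(2)] path3.length_awalk_verts[of u p] by simp
  with \<open>\<not> length p < 3\<close> have "length p = 3"
    by simp
  then obtain a b c where "p = [a, b, c]"
    by (auto simp: length_Suc_conv numeral_3_eq_3)
  then show False
    using u by (auto simp: path3.awalk_simps)
qed

interpretation path3: tree_graph path3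
  by unfold_locales (fact path3_connected path3_cycle_length)+

lemma graph_diameter_path3: "graph_diameter path3 = 2"
proof (rule antisym)
  obtain u p v where "path3.apath u p v" "length p = graph_diameter path3"
    using path3.diametral_path[OF path3_connected] .
  then show "graph_diameter path3 \<le> 2"
    using path3.length_apath_less[of u p v] by simp
  have "path3.awalk 0 [(0, 1), (1, 2)] 2" "reduced [(0, 1), (1, 2 :: nat)]"
    by (simp_all add: path3.awalk_simps reduced_Cons_iff)
  from path3.length_reduced_le_graph_diameter[OF this] show "2 \<le> graph_diameter path3"
    by simp
qed

lemma power_domination_number_path3: "power_domination_number path3 \<le> 1"
proof -
  have "colored path3 {1} (Suc 0) = pverts path3"
    by (auto simp: closed_nbhd_def neighbors_def)
  then have "power_dominating path3 {1}"
    unfolding power_dominating_def by (intro conjI exI[of _ "Suc 0"]) simp_all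
  from path3.power_domination_number_le[OF this] show ?thesis
    by simp
qed

theorem theorem12:
  shows "(\<forall>T :: 'a pair_pre_digraph. undirected_tree T \<and> card (pverts T) \<ge> 3 \<longrightarrow>
            \<lceil>sqrt (2 * (real (graph_diameter T) + 1)) - 1 / 2\<rceil> \<le> int (pd_throttling_number T) \<and>
            int (pd_throttling_number T)
              \<le> int (graph_diameter T) - 1 + int (power_domination_number T)) \<and>
         (\<exists>T :: nat pair_pre_digraph. undirected_tree T \<and> card (pverts T) \<ge> 3 \<and>
            \<lceil>sqrt (2 * (real (graph_diameter T) + 1)) - 1 / 2\<rceil> = int (pd_throttling_number T)) \<and>
         (\<exists>T :: nat pair_pre_digraph. undirected_tree T \<and> card (pverts T) \<ge> 3 \<and>
            int (pd_throttling_number T)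
              = int (graph_diameter T) - 1 + int (power_domination_number T))"
proof -
  have bounds: "\<lceil>sqrt (2 * (real (graph_diameter T) + 1)) - 1 / 2\<rceil> \<le> int (pd_throttling_number T) \<and>
      int (pd_throttling_number T) \<le> int (graph_diameter T) - 1 + int (power_domination_number T)"
    if "undirected_tree T" "card (pverts T) \<ge> 3" for T :: "'b pair_pre_digraph"
  proof -
    interpret tree_graph T
      using that(1) by (simp add: undirected_tree_iff_tree_graph)
    show ?thesis
      using pd_throttling_number_lower_bound[OF connected] pd_throttling_number_upper_bound[OF that(2)]
      by linarith
  qed
  have path3: "undirected_tree path3" "card (pverts path3) \<ge> 3"
    using path3.tree_graph_axioms by (simp_all add: undirected_tree_iff_tree_graph)
  \<comment> \<open>At diameter 2 the lower bound is \<open>sqrt 6 - 1 / 2\<close>, which exceeds 1,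
    rounded up to at least 2. The upper bound is at most 2 - 1 + 1 = 2, so both bounds and the
    throttling number equal 2.\<close>
  have "3 / 2 < sqrt (6 :: real)"
    by (rule real_less_rsqrt) (simp add: power2_eq_square)
  then have "2 \<le> \<lceil>sqrt (2 * (real (graph_diameter path3) + 1)) - 1 / 2\<rceil>"
    by (simp add: graph_diameter_path3 le_ceiling_iff)
  then have "\<lceil>sqrt (2 * (real (graph_diameter path3) + 1)) - 1 / 2\<rceil> = int (pd_throttling_number path3)"
    "int (pd_throttling_number path3)
      = int (graph_diameter path3) - 1 + int (power_domination_number path3)"
    using path3.pd_throttling_number_lower_bound[OF path3_connected]
      path3.pd_throttling_number_upper_bound[OF path3(2)]
      graph_diameter_path3 power_domination_number_path3
    by linarith+
  with bounds path3 show ?thesis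
    by blast
qed

end
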